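(* Let $G$ be a locally compact second countable topological group and let $\{T_g\}_{g\in G}$ be a nonsingular properly ergodic Borel $G$-action on a standard Borel probability space $(X,m)$ with $m$ nonatomic. If $\{T_g\}$ is weak doubly ergodic, then it is ergodic with isometric coefficients (EIC).
   Context: The action is nonsingular if each $T_g$ preserves the class of $m$-null sets; it is properly ergodic if it is ergodic and every orbit is $m$-null. The action is weak doubly ergodic if for all measurable sets $A,B\subset X$ of positive measure there exists $g\in G$ with $m(T_gA\cap A)>0$ and $m(T_gA\cap B)>0$. The action is ergodic with isometric coefficients (EIC) if every factor map (i.e. Borel $G$-equivariant map) $\phi:X\to Z$, where $(Z,d)$ is a separable metric space with a Borel $G$-action by isometries of $d$, is constant $m$-almost everywhere. *)

theory Defs
  imports "HOL-Probability.Probability"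
begin

text \<open>
  A topological group is a type of class \<^class>\<open>topological_group_add\<close>; despite the additive
  notation, such groups need not be commutative.
\<close>

definition borel_of :: "'a topology \<Rightarrow> 'a measure" where
  "borel_of \<tau> = sigma (topspace \<tau>) {U. openin \<tau> U}"

definition standard_borel :: "'a measure \<Rightarrow> bool" where
  "standard_borel M \<longleftrightarrow>
     (\<exists>\<tau>. completely_metrizable_space \<tau> \<and> separable_space \<tau> \<and> sets M = sets (borel_of \<tau>))"

definition nonatomic :: "'a measure \<Rightarrow> bool" where
  "nonatomic M \<longleftrightarrow>
     (\<forall>A\<in>sets M. 0 < emeasure M A \<longrightarrow>
        (\<exists>B\<in>sets M. B \<subseteq> A \<and> 0 < emeasure M B \<and> emeasure M B < emeasure M A))"

text \<open>
  Only the \<open>\<sigma>\<close>-algebra of the second argument matters here. The values of \<open>T g\<close> outside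
  \<open>space M\<close> are irrelevant.
\<close>

definition borel_action :: "('g::topological_group_add \<Rightarrow> 'a \<Rightarrow> 'a) \<Rightarrow> 'a measure \<Rightarrow> bool" where
  "borel_action T M \<longleftrightarrow>
     (\<lambda>(g, x). T g x) \<in> borel \<Otimes>\<^sub>M M \<rightarrow>\<^sub>M M \<and>
     (\<forall>x\<in>space M. T 0 x = x) \<and>
     (\<forall>g h. \<forall>x\<in>space M. T (g + h) x = T g (T h x))"

definition nonsingular_action :: "('g \<Rightarrow> 'a \<Rightarrow> 'a) \<Rightarrow> 'a measure \<Rightarrow> bool" where
  "nonsingular_action T M \<longleftrightarrow>
     (\<forall>g. \<forall>A\<in>sets M. T g ` A \<in> null_sets M \<longleftrightarrow> A \<in> null_sets M)"

definition ergodic_action :: "('g \<Rightarrow> 'a \<Rightarrow> 'a) \<Rightarrow> 'a measure \<Rightarrow> bool" where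
  "ergodic_action T M \<longleftrightarrow>
     (\<forall>A\<in>sets M. (\<forall>g. T g ` A = A) \<longrightarrow> A \<in> null_sets M \<or> space M - A \<in> null_sets M)"

text \<open>
  Orbits are null in the sense of the completion, so that their measurability is not
  part of the hypothesis.
\<close>

definition properly_ergodic_action :: "('g \<Rightarrow> 'a \<Rightarrow> 'a) \<Rightarrow> 'a measure \<Rightarrow> bool" where
  "properly_ergodic_action T M \<longleftrightarrow>
     ergodic_action T M \<and>
     (\<forall>x\<in>space M. range (\<lambda>g. T g x) \<in> null_sets (completion M))"

definition weak_doubly_ergodic :: "('g \<Rightarrow> 'a \<Rightarrow> 'a) \<Rightarrow> 'a measure \<Rightarrow> bool" where
  "weak_doubly_ergodic T M \<longleftrightarrow>
     (\<forall>A\<in>sets M. \<forall>B\<in>sets M. 0 < emeasure M A \<longrightarrow> 0 < emeasure M B \<longrightarrow>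
        (\<exists>g. 0 < emeasure M (T g ` A \<inter> A) \<and> 0 < emeasure M (T g ` A \<inter> B)))"

definition isometric_action :: "('g \<Rightarrow> 'z \<Rightarrow> 'z) \<Rightarrow> 'z metric \<Rightarrow> bool" where
  "isometric_action S Z \<longleftrightarrow>
     (\<forall>g. \<forall>z\<in>mspace Z. \<forall>w\<in>mspace Z. mdist Z (S g z) (S g w) = mdist Z z w)"

definition factor_map ::
    "('g \<Rightarrow> 'a \<Rightarrow> 'a) \<Rightarrow> 'a measure \<Rightarrow> ('g \<Rightarrow> 'z \<Rightarrow> 'z) \<Rightarrow> 'z measure \<Rightarrow> ('a \<Rightarrow> 'z) \<Rightarrow> bool" where
  "factor_map T M S N \<phi> \<longleftrightarrow>
     \<phi> \<in> M \<rightarrow>\<^sub>M N \<and> (\<forall>g. \<forall>x\<in>space M. \<phi> (T g x) = S g (\<phi> x))"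

text \<open>
  A definition cannot quantify over types, so the type in which the metric spaces live is a
  parameter. A statement with conclusion \<open>EIC TYPE('z) T M\<close> for a free type variable \<open>'z\<close>
  covers all separable metric spaces.
\<close>

definition EIC ::
    "'z itself \<Rightarrow> ('g::topological_group_add \<Rightarrow> 'a \<Rightarrow> 'a) \<Rightarrow> 'a measure \<Rightarrow> bool" where
  "EIC _ T M \<longleftrightarrow>
     (\<forall>(Z :: 'z metric) S \<phi>.
        separable_space (mtopology_of Z) \<longrightarrow>
        borel_action S (borel_of (mtopology_of Z)) \<longrightarrow>
        isometric_action S Z \<longrightarrow>
        factor_map T M S (borel_of (mtopology_of Z)) \<phi> \<longrightarrow>
        (\<exists>c\<in>mspace Z. AE x in M. \<phi> x = c))"

end

theory Submission
  imports Defs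
begin

text \<open>
  By separability, the push-forward of \<open>m\<close> under a factor map \<open>\<phi>\<close> has a support point \<open>c\<close>. If
  \<open>\<phi>\<close> is not almost everywhere equal to \<open>c\<close>, then for some \<open>e > 0\<close> both
  \<open>A = {x. d (\<phi> x) c < e}\<close> and \<open>B = {x. d (\<phi> x) c \<ge> 3 * e}\<close> have positive measure. If \<open>T g A\<close>
  meets \<open>A\<close>, then the isometry \<open>S g\<close> maps the \<open>e\<close>-ball around \<open>c\<close>, whose diameter is at most
  \<open>2 * e\<close>, to a set meeting that ball, so \<open>\<phi>\<close> maps \<open>T g A\<close> into the \<open>3 * e\<close>-ball around \<open>c\<close>.
  Hence \<open>T g A\<close> misses \<open>B\<close>, against weak double ergodicity.
\<close>

lemma space_borel_of [simp]: "space (borel_of \<tau>) = topspace \<tau>"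
  unfolding borel_of_def by (rule space_measure_of) (auto dest: openin_subset)

lemma openin_imp_sets_borel_of: "openin \<tau> U \<Longrightarrow> U \<in> sets (borel_of \<tau>)"
  unfolding borel_of_def by (subst sets_measure_of) (auto dest: openin_subset)

text \<open>Balls of rational radius around the points of a countable dense set form a base. Second
  countability is wanted for the Lindelof property, on which the existence of a support point
  rests.\<close>

lemma (in Metric_space) separable_space_imp_second_countable:
  assumes "separable_space mtopology"
  shows "second_countable mtopology"
proof -
  obtain C where C: "countable C" "C \<subseteq> M" "mtopology closure_of C = M"
    using assms by (auto simp: separable_space_def)
  define \<B> where "\<B> = (\<lambda>(a, q). mball a (real_of_rat q)) ` (C \<times> UNIV)"
  have "countable \<B>"
    using C(1) by (auto simp: \<B>_def intro!: countable_image countable_SIGMA)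
  moreover have "\<forall>V\<in>\<B>. openin mtopology V"
    by (auto simp: \<B>_def)
  moreover have "\<exists>V\<in>\<B>. x \<in> V \<and> V \<subseteq> U" if U: "openin mtopology U" "x \<in> U" for U x
  proof -
    obtain r where r: "r > 0" "mball x r \<subseteq> U"
      using U unfolding openin_mtopology by blast
    \<comment> \<open>With \<open>a\<close> within \<open>q\<close> of \<open>x\<close>, the ball of
      radius \<open>q\<close> around \<open>a\<close> contains \<open>x\<close> and stays within
      distance \<open>2 * q < r\<close> of \<open>x\<close>; hence the bound
      \<open>r / 2\<close>.\<close>
    obtain q where q: "0 < real_of_rat q" "real_of_rat q < r / 2"
      using of_rat_dense[of 0 "r / 2"] r(1) by auto
    have x: "x \<in> M"
      using U openin_subset by fastforce
    then obtain a where a: "a \<in> C" "a \<in> mball x (real_of_rat q)"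
      using C(3) q(1) unfolding metric_closure_of by blast
    have "mball a (real_of_rat q) \<subseteq> mball x r"
      using a(2) q(2) by (intro mball_subset) (auto simp: commute)
    with r(2) have "mball a (real_of_rat q) \<subseteq> U"
      by blast
    moreover have "x \<in> mball a (real_of_rat q)"
      using a(2) by (auto simp: commute)
    moreover have "mball a (real_of_rat q) \<in> \<B>"
      using a(1) by (auto simp: \<B>_def)
    ultimately show ?thesis by blast
  qed
  ultimately show ?thesis
    unfolding second_countable_def by blast
qed

text \<open>If every point had an open neighbourhood with null preimage, countably many of these
  would cover the space, and \<open>space M\<close> would be a countable union of null sets.\<close>

lemma Lindelof_obtains_support_point:
  assumes "Lindelof_space \<tau>" and f: "f \<in> M \<rightarrow>\<^sub>M borel_of \<tau>" and pos: "emeasure M (space M) \<noteq> 0"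
  obtains c where "c \<in> topspace \<tau>"
    and "\<And>U. openin \<tau> U \<Longrightarrow> c \<in> U \<Longrightarrow> 0 < emeasure M (f -` U \<inter> space M)"
proof (rule ccontr)
  assume "\<not> thesis"
  with that have null: "\<exists>U. openin \<tau> U \<and> c \<in> U \<and> emeasure M (f -` U \<inter> space M) = 0"
    if "c \<in> topspace \<tau>" for c
    using \<open>c \<in> topspace \<tau>\<close> by (metis zero_less_iff_neq_zero)
  define \<U> where "\<U> = {U. openin \<tau> U \<and> emeasure M (f -` U \<inter> space M) = 0}"
  have "\<Union>\<U> = topspace \<tau>"
    using null by (auto simp: \<U>_def dest: openin_subset)
  moreover have "\<forall>U\<in>\<U>. openin \<tau> U"
    by (simp add: \<U>_def)
  ultimately obtain \<V> where \<V>: "countable \<V>" "\<V> \<subseteq> \<U>" "\<Union>\<V> = topspace \<tau>"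
    using \<open>Lindelof_space \<tau>\<close> unfolding Lindelof_space_def by metis
  have "f -` U \<inter> space M \<in> null_sets M" if "U \<in> \<V>" for U
    using that \<V>(2) measurable_sets[OF f openin_imp_sets_borel_of] by (auto simp: \<U>_def null_sets_def)
  then have "(\<Union>U\<in>\<V>. f -` U \<inter> space M) \<in> null_sets M"
    by (rule null_sets_UN'[OF \<V>(1)])
  moreover have "(\<Union>U\<in>\<V>. f -` U \<inter> space M) = space M"
    using \<V>(3) measurable_space[OF f] by fastforce
  ultimately show False
    using pos by auto
qed

lemma weak_doubly_ergodic_isometric_factor_constant:
  fixes Z :: "'z metric"
  assumes wde: "weak_doubly_ergodic T M"
    and pos: "emeasure M (space M) \<noteq> 0"
    and sep: "separable_space (mtopology_of Z)"
    and iso: "isometric_action S Z"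
    and fac: "factor_map T M S (borel_of (mtopology_of Z)) \<phi>"
  shows "\<exists>c\<in>mspace Z. AE x in M. \<phi> x = c"
proof -
  interpret Metric_space "mspace Z" "mdist Z" by simp
  have top: "mtopology_of Z = mtopology"
    by (simp add: mtopology_of_def)
  have \<phi>: "\<phi> \<in> M \<rightarrow>\<^sub>M borel_of mtopology"
    and equiv: "\<And>g x. x \<in> space M \<Longrightarrow> \<phi> (T g x) = S g (\<phi> x)"
    using fac by (auto simp: factor_map_def top)
  have \<phi>_in: "\<phi> x \<in> mspace Z" if "x \<in> space M" for x
    using measurable_space[OF \<phi> that] by simp
  have "Lindelof_space mtopology"
    using sep by (simp add: top separable_space_imp_second_countable second_countable_imp_Lindelof_space)
  then obtain c where c: "c \<in> mspace Z"
    and supp: "\<And>U. openin mtopology U \<Longrightarrow> c \<in> U \<Longrightarrow> 0 < emeasure M (\<phi> -` U \<inter> space M)"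
    by (rule Lindelof_obtains_support_point[OF _ \<phi> pos]) auto
  have near: "AE x in M. mdist Z c (\<phi> x) < 3 * e" if "e > 0" for e
  proof -
    define A where "A = \<phi> -` mball c e \<inter> space M"
    \<comment> \<open>Taking the complement of the preimage of an open ball makes measurability of
      \<open>B\<close> immediate.\<close>
    define B where "B = space M - (\<phi> -` mball c (3 * e) \<inter> space M)"
    have sets: "A \<in> sets M" "B \<in> sets M"
      using measurable_sets[OF \<phi> openin_imp_sets_borel_of[OF openin_mball]] by (auto simp: A_def B_def)
    have "emeasure M B = 0"
    proof (rule ccontr)
      assume "emeasure M B \<noteq> 0"
      moreover have "0 < emeasure M A"
        unfolding A_def using c \<open>e > 0\<close> by (intro supp) auto
      ultimately obtain g where "0 < emeasure M (T g ` A \<inter> A)" "0 < emeasure M (T g ` A \<inter> B)"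
        using wde sets unfolding weak_doubly_ergodic_def by (metis zero_less_iff_neq_zero)
      \<comment> \<open>From here the argument is pointwise: positive measure serves only to supply
        one point in each intersection.\<close>
      then have "T g ` A \<inter> A \<noteq> {}" "T g ` A \<inter> B \<noteq> {}"
        by (metis emeasure_empty less_irrefl)+
      then obtain x y where x: "x \<in> A" "T g x \<in> A" and y: "y \<in> A" "T g y \<in> B"
        by auto
      have in_Z: "\<phi> x \<in> mspace Z" "\<phi> y \<in> mspace Z" "\<phi> (T g x) \<in> mspace Z" "\<phi> (T g y) \<in> mspace Z"
        using x y by (auto simp: A_def B_def intro: \<phi>_in)
      have "mdist Z (\<phi> (T g x)) (\<phi> (T g y)) = mdist Z (\<phi> x) (\<phi> y)"
        using iso in_Z x y equiv by (simp add: isometric_action_def A_def)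
      \<comment> \<open>Passing through the centre \<open>c\<close> bounds the diameter of the ball.
        Together with the distance from \<open>c\<close> to \<open>\<phi> (T g x)\<close> this gives
        three terms, each below \<open>e\<close>, which is where the factor 3 comes from.\<close>
      also have "\<dots> \<le> mdist Z c (\<phi> x) + mdist Z c (\<phi> y)"
        using triangle''[OF in_Z(2) c in_Z(1)] triangle[OF in_Z(1) c in_Z(2)] commute by metis
      finally have "mdist Z c (\<phi> (T g y)) \<le> mdist Z c (\<phi> (T g x)) + mdist Z c (\<phi> x) + mdist Z c (\<phi> y)"
        using triangle[OF c in_Z(3,4)] by linarith
      moreover have "mdist Z c (\<phi> (T g x)) < e" "mdist Z c (\<phi> x) < e" "mdist Z c (\<phi> y) < e"
        using x y by (auto simp: A_def)
      moreover have "3 * e \<le> mdist Z c (\<phi> (T g y))"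
        using y(2) c in_Z(4) by (auto simp: B_def)
      ultimately show False by linarith
    qed
    then show ?thesis
      using sets by (intro AE_I'[of B]) (auto simp: B_def null_sets_def c \<phi>_in)
  qed
  \<comment> \<open>The exceptional null set in \<open>near\<close> depends on \<open>e\<close>.
    Restricting \<open>e\<close> to the countably many values \<open>1 / (n + 1)\<close> yields a
    single null set for all of them.\<close>
  have "AE x in M. \<forall>n::nat. mdist Z c (\<phi> x) < 3 * inverse (real (Suc n))"
    unfolding AE_all_countable by (intro allI near) simp
  then have "AE x in M. \<phi> x = c"
  proof (rule AE_mp, intro AE_I2 impI)
    fix x assume x: "x \<in> space M" and small: "\<forall>n::nat. mdist Z c (\<phi> x) < 3 * inverse (real (Suc n))"
    have "mdist Z c (\<phi> x) = 0"
    proof (rule ccontr)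
      assume "mdist Z c (\<phi> x) \<noteq> 0"
      then have "0 < mdist Z c (\<phi> x) / 3"
        using nonneg[of c "\<phi> x"] by linarith
      then obtain n where "inverse (real (Suc n)) < mdist Z c (\<phi> x) / 3"
        using reals_Archimedean by blast
      then show False
        using small[rule_format, of n] by linarith
    qed
    then show "\<phi> x = c"
      using zero[OF c \<phi>_in[OF x]] by simp
  qed
  with c show ?thesis by blast
qed

theorem proposition7p2:
  fixes T :: "'g::{topological_group_add, second_countable_topology} \<Rightarrow> 'x \<Rightarrow> 'x"
    and m :: "'x measure"
  assumes "locally_compact_space (euclidean :: 'g topology)"
    and "prob_space m"
    and "standard_borel m"
    and "nonatomic m"
    and "borel_action T m"
    and "nonsingular_action T m"
    and "properly_ergodic_action T m"
    and "weak_doubly_ergodic T m"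
  shows "EIC TYPE('z) T m"
proof -
  \<comment> \<open>Total mass 1 rules out the zero measure, whose push-forward has no support
    point.\<close>
  have "emeasure m (space m) \<noteq> 0"
    using prob_space.emeasure_space_1[OF \<open>prob_space m\<close>] by simp
  with \<open>weak_doubly_ergodic T m\<close> show ?thesis
    unfolding EIC_def by (blast intro: weak_doubly_ergodic_isometric_factor_constant)
qed

end
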